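(* Let $Y=[y_1,\dots,y_p]\in\mathbb{R}^{n\times p}$, $f(x)=\|Y^\top x\|_1=\sum_{j=1}^p|y_j^\top x|$, and $\mathcal{M}=\{x\in\mathbb{R}^n:\|x\|_2=1\}$. For any $\lambda\in(0,1/(p\bar L))$, the point $\bar x$ output by the StManPPA algorithm (described in the context) with initial point $x^0\in\mathcal{M}$ and step sizes $t_0,\dots,t_T>0$ satisfies $$\mathbb{E}\left[\Theta_\lambda(\bar x)^2\right]\le\frac{2\lambda e_\lambda(x^0)+\bar L^2\sum_{k=0}^Tt_k^2}{\lambda\left((1/p)-\lambda\bar L\right)\sum_{k=0}^Tt_k},$$ where the expectation is taken over all random choices made by the algorithm. In particular, if the step sizes $\{t_k\}_k$ satisfy $\sum_{k=0}^\infty t_k=\infty$ and $\sum_{k=0}^\infty t_k^2<\infty$, then $\mathbb{E}[\Theta_\lambda(\bar x)^2]\to0$ as $T\to\infty$. Moreover, if $t_k=\frac{1}{\sqrt{T+1}}$ for $k=0,1,\dots,T$, then the number of iterations needed by StManPPA to obtain a point $\bar x\in\mathcal{M}$ satisfying $\mathbb{E}[\Theta_\lambda(\bar x)]\le\epsilon$ is $\mathcal{O}(\epsilon^{-4})$; that is, there is a constant $C>0$ independent of $\epsilon$ and $T$ such that, for every $\epsilon>0$, $T+1\ge C\epsilon^{-4}$ implies $\mathbb{E}[\Theta_\lambda(\bar x)]\le\epsilon$.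
   Context: For $j=1,\dots,p$, $f_j(x)=|y_j^\top x|$, $L_j>0$ is the Lipschitz constant of $f_j$ with respect to $\|\cdot\|_2$ on $\mathbb{R}^n$, and $\bar L=\max_{1\le j\le p}L_j$. $\mathrm{Proj}_{\mathcal{M}}(x)=x/\|x\|_2$ for $x\neq0$. For $\lambda>0$ and $z\in\mathbb{R}^n$, the Moreau envelope on $\mathcal{M}$ is $e_\lambda(z)=\min_{x\in\mathcal{M}}\{f(x)+\frac{1}{2\lambda}\|x-z\|_2^2\}$, and $\mathrm{mprox}_{\lambda f}(z)$ denotes a (fixed, arbitrarily selected) element of $\mathrm{argmin}_{x\in\mathcal{M}}\{\lambda f(x)+\frac12\|x-z\|_2^2\}$. For $x\in\mathcal{M}$, $\Theta_\lambda(x)=\frac1\lambda\|x-\mathrm{mprox}_{\lambda f}(x)\|_2$. StManPPA algorithm. Input: $x^0\in\mathcal{M}$, $t_0,t_1,\dots,t_T>0$. For $k=0,1,\dots,T$: select $j_k\in\{1,\dots,p\}$ uniformly at random (independently of the past); let $d^k$ be the unique solution of $$\min_{d\in\mathbb{R}^n}\ |y_{j_k}^\top(x^k+d)|+\frac{1}{2t_k}\|d\|_2^2\quad\text{s.t.}\quad d^\top x^k=0;$$ set $x^{k+1}=\mathrm{Proj}_{\mathcal{M}}(x^k+d^k)$. Output: $\bar x=x^k$ with probability $t_k/\sum_{i=0}^Tt_i$ for $k=0,\dots,T$ (this choice being independent of the $j_k$'s). *)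

theory Defs
  imports "HOL-Probability.Probability"
begin

abbreviation unit_sphere :: "(real ^ 'n) set" where
  "unit_sphere \<equiv> sphere 0 1"

definition l1_norm :: "real ^ 'm \<Rightarrow> real" where
  "l1_norm v = (\<Sum>i\<in>UNIV. \<bar>v $ i\<bar>)"

definition obj :: "real ^ 'p ^ 'n \<Rightarrow> real ^ 'n \<Rightarrow> real" where
  "obj Y x = l1_norm (transpose Y *v x)"

definition obj_part :: "real ^ 'p ^ 'n \<Rightarrow> 'p \<Rightarrow> real ^ 'n \<Rightarrow> real" where
  "obj_part Y j x = \<bar>column j Y \<bullet> x\<bar>"

lemma obj_eq_sum: "obj Y x = (\<Sum>j\<in>UNIV. obj_part Y j x)"
  by (simp add: obj_def l1_norm_def obj_part_def matrix_vector_mult_def transpose_def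
      column_def inner_vec_def)

definition moreau_env :: "(real ^ 'n \<Rightarrow> real) \<Rightarrow> real \<Rightarrow> real ^ 'n \<Rightarrow> real" where
  "moreau_env f lam z = (INF x\<in>unit_sphere. f x + 1 / (2 * lam) * (norm (x - z))\<^sup>2)"

(* For continuous f the infimum is a minimum. *)
lemma moreau_env_attained:
  fixes f :: "real ^ 'n \<Rightarrow> real"
  assumes "continuous_on unit_sphere f"
  shows "\<exists>x\<in>unit_sphere. moreau_env f lam z = f x + 1 / (2 * lam) * (norm (x - z))\<^sup>2
           \<and> (\<forall>u\<in>unit_sphere. moreau_env f lam z \<le> f u + 1 / (2 * lam) * (norm (u - z))\<^sup>2)"
proof -
  let ?g = "\<lambda>x. f x + 1 / (2 * lam) * (norm (x - z))\<^sup>2"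
  have "(unit_sphere :: (real ^ 'n) set) \<noteq> {}"
    by simp
  moreover have "continuous_on unit_sphere ?g"
    by (intro continuous_intros assms)
  ultimately obtain x where x: "x \<in> unit_sphere" "\<forall>u\<in>unit_sphere. ?g x \<le> ?g u"
    using continuous_attains_inf[OF compact_sphere] by blast
  then have "moreau_env f lam z = ?g x"
    unfolding moreau_env_def by (intro cInf_eq_minimum) auto
  with x show ?thesis by auto
qed

(* The minimiser need not be unique: a selection m picks one for every z. *)
definition mprox_selection ::
    "(real ^ 'n \<Rightarrow> real) \<Rightarrow> real \<Rightarrow> (real ^ 'n \<Rightarrow> real ^ 'n) \<Rightarrow> bool" where
  "mprox_selection f lam m \<longleftrightarrow>
     (\<forall>z. is_arg_min (\<lambda>x. lam * f x + 1 / 2 * (norm (x - z))\<^sup>2) (\<lambda>x. x \<in> unit_sphere) (m z))"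

definition Theta :: "real \<Rightarrow> (real ^ 'n \<Rightarrow> real ^ 'n) \<Rightarrow> real ^ 'n \<Rightarrow> real" where
  "Theta lam m x = 1 / lam * norm (x - m x)"

definition proj_sphere :: "real ^ 'n \<Rightarrow> real ^ 'n" where
  "proj_sphere x = x /\<^sub>R norm x"

definition manppa_dir :: "real ^ 'p ^ 'n \<Rightarrow> 'p \<Rightarrow> real \<Rightarrow> real ^ 'n \<Rightarrow> real ^ 'n" where
  "manppa_dir Y j s x =
     (THE d. is_arg_min (\<lambda>d. \<bar>column j Y \<bullet> (x + d)\<bar> + 1 / (2 * s) * (norm d)\<^sup>2)
                        (\<lambda>d. d \<bullet> x = 0) d)"

(* The description operator is justified: the subproblem has exactly one solution. *)
lemma manppa_dir_unique:
  fixes x :: "real ^ 'n"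
  assumes s: "s > 0"
  shows "\<exists>!d. is_arg_min (\<lambda>d. \<bar>column j Y \<bullet> (x + d)\<bar> + 1 / (2 * s) * (norm d)\<^sup>2)
                         (\<lambda>d. d \<bullet> x = 0) d"
proof -
  let ?y = "column j Y"
  let ?g = "\<lambda>d. \<bar>?y \<bullet> (x + d)\<bar> + 1 / (2 * s) * (norm d)\<^sup>2"
  let ?S = "{d. d \<bullet> x = 0}"
  define R where "R = sqrt (2 * s * ?g 0)"
  have "closed ?S"
    by (intro closed_Collect_eq continuous_intros)
  then have "compact (cball 0 R \<inter> ?S)"
    by (intro compact_Int_closed compact_cball)
  moreover have R: "R \<ge> 0" "R\<^sup>2 = 2 * s * ?g 0"
    using s by (auto simp: R_def)
  then have "0 \<in> cball 0 R \<inter> ?S" by auto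
  moreover have "continuous_on (cball 0 R \<inter> ?S) ?g"
    by (intro continuous_intros)
  ultimately obtain d where d: "d \<in> cball 0 R \<inter> ?S" "\<forall>u \<in> cball 0 R \<inter> ?S. ?g d \<le> ?g u"
    using continuous_attains_inf[of "cball 0 R \<inter> ?S" ?g] by blast
  have min: "?g d \<le> ?g u" if u: "u \<in> ?S" for u
  proof (cases "norm u \<le> R")
    case True
    with u d show ?thesis by auto
  next
    case False
    then have "R\<^sup>2 \<le> (norm u)\<^sup>2"
      using R(1) by (intro power_mono) auto
    then have "?g 0 \<le> 1 / (2 * s) * (norm u)\<^sup>2"
      using s R(2) by (simp add: field_simps)
    moreover have "?g d \<le> ?g 0"
      using d(2) \<open>0 \<in> cball 0 R \<inter> ?S\<close> by blast
    ultimately show ?thesis by linarith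
  qed
  show ?thesis
  proof (rule ex1I[of _ d])
    show "is_arg_min ?g (\<lambda>d. d \<bullet> x = 0) d"
      using d(1) min by (auto simp: is_arg_min_linorder)
  next
    fix e assume "is_arg_min ?g (\<lambda>d. d \<bullet> x = 0) e"
    then have e: "e \<in> ?S" "?g e \<le> ?g d"
      using d(1) by (auto simp: is_arg_min_linorder)
    define m where "m = (1 / 2) *\<^sub>R (d + e)"
    have "m \<in> ?S"
      using d(1) e(1) by (simp add: m_def inner_add_left)
    then have dm: "?g d \<le> ?g m" by (rule min)
    have "?y \<bullet> (x + m) = (?y \<bullet> (x + d) + ?y \<bullet> (x + e)) / 2"
      by (simp add: m_def inner_add_right field_simps)
    then have a: "\<bar>?y \<bullet> (x + m)\<bar> \<le> (\<bar>?y \<bullet> (x + d)\<bar> + \<bar>?y \<bullet> (x + e)\<bar>) / 2"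
      using abs_triangle_ineq[of "?y \<bullet> (x + d)" "?y \<bullet> (x + e)"] by simp
    have "(norm m)\<^sup>2 = ((norm d)\<^sup>2 + (norm e)\<^sup>2) / 2 - (norm (d - e))\<^sup>2 / 4"
      by (simp add: m_def power2_norm_eq_inner inner_add_left inner_add_right
          inner_diff_left inner_diff_right inner_commute field_simps)
    then have "1 / (2 * s) * (norm m)\<^sup>2 = (1 / (2 * s) * (norm d)\<^sup>2 + 1 / (2 * s) * (norm e)\<^sup>2) / 2
                 - 1 / (2 * s) * ((norm (d - e))\<^sup>2 / 4)"
      by (simp add: right_diff_distrib distrib_left add_divide_distrib)
    with a dm e(2) have "1 / (2 * s) * ((norm (d - e))\<^sup>2 / 4) \<le> 0" by argo
    then have "(norm (d - e))\<^sup>2 \<le> 0"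
      using s by (simp add: mult_le_0_iff divide_le_0_iff)
    then show "e = d" by simp
  qed
qed

(* The iterates as a function of the realised indices js 0, js 1, ... *)
primrec stmanppa_iter ::
    "real ^ 'p ^ 'n \<Rightarrow> (nat \<Rightarrow> real) \<Rightarrow> real ^ 'n \<Rightarrow> (nat \<Rightarrow> 'p) \<Rightarrow> nat \<Rightarrow> real ^ 'n" where
  "stmanppa_iter Y t x0 js 0 = x0"
| "stmanppa_iter Y t x0 js (Suc k) =
     (let x = stmanppa_iter Y t x0 js k in proj_sphere (x + manppa_dir Y (js k) (t k) x))"

definition output_index :: "(nat \<Rightarrow> real) \<Rightarrow> nat \<Rightarrow> nat pmf" where
  "output_index t T = embed_pmf (\<lambda>k. if k \<le> T then t k / (\<Sum>i\<le>T. t i) else 0)"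

lemma pmf_output_index:
  assumes "\<And>k. k \<le> T \<Longrightarrow> t k > 0"
  shows "pmf (output_index t T) k = (if k \<le> T then t k / (\<Sum>i\<le>T. t i) else 0)"
proof -
  let ?q = "\<lambda>k. if k \<le> T then t k / (\<Sum>i\<le>T. t i) else 0"
  have pos: "(\<Sum>i\<le>T. t i) > 0"
    using assms by (intro sum_pos) auto
  have nonneg: "?q k \<ge> 0" for k
    using assms[of k] pos by auto
  have "(\<integral>\<^sup>+k. ennreal (?q k) \<partial>count_space UNIV)
      = (\<integral>\<^sup>+k. ennreal (?q k) \<partial>count_space {..T})"
    by (rule nn_integral_count_space_eq) auto
  also have "\<dots> = (\<Sum>k\<le>T. ennreal (?q k))"
    by (rule nn_integral_count_space_finite) simp
  also have "\<dots> = ennreal (\<Sum>k\<le>T. ?q k)"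
    using nonneg by (intro sum_ennreal)
  also have "(\<Sum>k\<le>T. ?q k) = 1"
    using pos by (simp flip: sum_divide_distrib)
  finally show ?thesis
    unfolding output_index_def using nonneg by (intro pmf_embed_pmf) auto
qed

(* Law of the output: the indices js 0, ..., js T are independent and uniform, and the
   output index k is drawn independently of them. *)
definition stmanppa ::
    "real ^ 'p ^ 'n \<Rightarrow> (nat \<Rightarrow> real) \<Rightarrow> real ^ 'n \<Rightarrow> nat \<Rightarrow> (real ^ 'n) pmf" where
  "stmanppa Y t x0 T =
     map_pmf (\<lambda>(js, k). stmanppa_iter Y t x0 js k)
       (pair_pmf (Pi_pmf {..T} undefined (\<lambda>_. pmf_of_set UNIV)) (output_index t T))"

end

(* One step of the iteration is a proximal step for a single summand in the tangent space,
   followed by a retraction.  Comparing the iterate with the Moreau minimiser xhat of x, the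
   tangential part of xhat - x is feasible for the subproblem, and its normal part has length
   |xhat - x|^2 / 2, so strong convexity of the subproblem bounds |xhat - x - d|^2.  The retraction
   is the nearest-point map onto the unit ball, hence does not increase the distance to xhat.
   Averaging over the summand gives an expected decrease of the Moreau envelope by a multiple of
   t_k Theta^2, up to a t_k^2 error; the bound follows by telescoping. *)
theory Submission
  imports Defs
begin

section \<open>The proximal step\<close>

text \<open>Compare \<open>d\<close> with points on the segment from \<open>d\<close> to
  \<open>u\<close>. The quadratic lies below its chord by exactly
  \<open>\<tau> * (1 - \<tau>) * c\<close> times the squared length of the segment; dividing by
  \<tau> and letting \<tau> tend to 0 leaves the full extra term.\<close>

lemma prox_three_point:
  fixes \<phi> :: "'a::real_inner \<Rightarrow> real"
  assumes min: "is_arg_min (\<lambda>d. \<phi> d + c * (norm d)\<^sup>2) (\<lambda>d. d \<in> S) d"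
    and conv: "convex_on S \<phi>" and u: "u \<in> S"
  shows "\<phi> d + c * (norm d)\<^sup>2 + c * (norm (u - d))\<^sup>2 \<le> \<phi> u + c * (norm u)\<^sup>2"
proof -
  have d: "d \<in> S" and le: "\<And>v. v \<in> S \<Longrightarrow> \<phi> d + c * (norm d)\<^sup>2 \<le> \<phi> v + c * (norm v)\<^sup>2"
    using min by (auto simp: is_arg_min_linorder)
  let ?a = "\<phi> u + c * (norm u)\<^sup>2 - (\<phi> d + c * (norm d)\<^sup>2)"
  have *: "(1 - \<tau>) * (c * (norm (u - d))\<^sup>2) \<le> ?a" if \<tau>: "0 < \<tau>" "\<tau> < 1" for \<tau> :: real
  proof -
    let ?v = "(1 - \<tau>) *\<^sub>R d + \<tau> *\<^sub>R u"
    have "?v \<in> S"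
      using convex_on_imp_convex[OF conv] d u \<tau> by (auto simp: convex_alt)
    then have v: "\<phi> d + c * (norm d)\<^sup>2 \<le> \<phi> ?v + c * (norm ?v)\<^sup>2"
      by (rule le)
    have \<phi>v: "\<phi> ?v \<le> (1 - \<tau>) * \<phi> d + \<tau> * \<phi> u"
      using convex_onD[OF conv, of \<tau> d u] d u \<tau> by auto
    have nv: "(norm ?v)\<^sup>2
        = (1 - \<tau>) * (norm d)\<^sup>2 + \<tau> * (norm u)\<^sup>2 - \<tau> * (1 - \<tau>) * (norm (u - d))\<^sup>2"
      unfolding power2_norm_eq_inner
      by (simp add: inner_add_left inner_add_right inner_diff_left inner_diff_right
          inner_commute algebra_simps)
    have "\<phi> d + c * (norm d)\<^sup>2 \<le> (1 - \<tau>) * \<phi> d + \<tau> * \<phi> u + c *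
        ((1 - \<tau>) * (norm d)\<^sup>2 + \<tau> * (norm u)\<^sup>2 - \<tau> * (1 - \<tau>) * (norm (u - d))\<^sup>2)"
      using v \<phi>v unfolding nv by linarith
    then have "\<tau> * ((1 - \<tau>) * (c * (norm (u - d))\<^sup>2)) \<le> \<tau> * ?a"
      by (simp add: algebra_simps)
    then show ?thesis
      using \<tau> by simp
  qed
  \<comment> \<open>The division by \<tau> excludes \<tau> = 0, so the coefficient 1 is reached only
    as a limit from the right.\<close>
  have "((\<lambda>\<tau>. (1 - \<tau>) * (c * (norm (u - d))\<^sup>2)) \<longlongrightarrow> (1 - 0) * (c * (norm (u - d))\<^sup>2)) (at_right 0)"
    by (intro tendsto_intros)
  moreover have "\<forall>\<^sub>F \<tau> in at_right 0. (1 - \<tau>) * (c * (norm (u - d))\<^sup>2) \<le> ?a"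
    using eventually_at_right_real[OF zero_less_one] by eventually_elim (use * in auto)
  ultimately have "(1 - 0) * (c * (norm (u - d))\<^sup>2) \<le> ?a"
    by (intro tendsto_upperbound) auto
  then show ?thesis by simp
qed

section \<open>The retraction onto the sphere\<close>

lemma norm_proj_sphere: "x \<noteq> 0 \<Longrightarrow> norm (proj_sphere x) = 1"
  by (simp add: proj_sphere_def)

text \<open>Normalising a point outside the open unit ball gives its nearest point in the closed
  ball. With \<open>w = r p\<close> and \<open>p\<close> a unit vector, the difference of the
  squared distances factors as (r - 1)(r + 1 - 2 <u, p>), and both factors are nonnegative.\<close>

lemma norm_proj_sphere_diff_le:
  fixes u w :: "real ^ 'n"
  assumes u: "norm u \<le> 1" and w: "1 \<le> norm w"
  shows "norm (u - proj_sphere w) \<le> norm (u - w)"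
proof -
  let ?p = "proj_sphere w" and ?r = "norm w"
  have p: "norm ?p = 1" and wp: "w = ?r *\<^sub>R ?p"
    using w norm_eq_zero[of w] by (auto simp: proj_sphere_def simp del: norm_eq_zero)
  have "u \<bullet> ?p \<le> norm u * norm ?p"
    by (rule norm_cauchy_schwarz)
  then have "0 \<le> (?r - 1) * (?r + 1 - 2 * (u \<bullet> ?p))"
    using u w p by (intro mult_nonneg_nonneg) auto
  also have "\<dots> = (norm (u - ?r *\<^sub>R ?p))\<^sup>2 - (norm (u - ?p))\<^sup>2"
    using p unfolding power2_norm_eq_inner norm_eq_1
    by (simp add: inner_diff_left inner_diff_right inner_commute algebra_simps)
  finally have "(norm (u - ?p))\<^sup>2 \<le> (norm (u - w))\<^sup>2"
    using wp by simp
  then show ?thesis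
    by (simp add: abs_le_square_iff)
qed

section \<open>The subproblem in the tangent space\<close>

lemma is_arg_min_manppa_dir:
  assumes "s > 0"
  shows "is_arg_min (\<lambda>d. \<bar>column j Y \<bullet> (x + d)\<bar> + 1 / (2 * s) * (norm d)\<^sup>2)
           (\<lambda>d. d \<bullet> x = 0) (manppa_dir Y j s x)"
  unfolding manppa_dir_def by (rule theI'[OF manppa_dir_unique[OF assms]])

text \<open>By Pythagoras, a tangent step from the sphere never enters the open unit ball, so the
  retraction divides by a nonzero norm and acts as a nearest-point map.\<close>

lemma norm_add_orthogonal_ge:
  fixes x d :: "'a::real_inner"
  assumes "d \<bullet> x = 0"
  shows "norm x \<le> norm (x + d)"
proof (rule power2_le_imp_le)
  show "(norm x)\<^sup>2 \<le> (norm (x + d))\<^sup>2"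
    using assms by (simp add: power2_norm_eq_inner inner_add_left inner_add_right inner_commute)
qed simp

lemma convex_on_obj_part_shift:
  fixes x :: "real ^ 'n"
  shows "convex_on {d. d \<bullet> x = 0} (\<lambda>d. \<bar>column j Y \<bullet> (x + d)\<bar>)"
proof (rule convex_onI)
  show "convex {d. d \<bullet> x = 0}"
    by (auto simp: convex_def inner_add_left)
  fix \<tau> :: real and u v :: "real ^ 'n"
  assume \<tau>: "0 < \<tau>" "\<tau> < 1"
  let ?y = "column j Y"
  have "?y \<bullet> (x + ((1 - \<tau>) *\<^sub>R u + \<tau> *\<^sub>R v)) = (1 - \<tau>) * (?y \<bullet> (x + u)) + \<tau> * (?y \<bullet> (x + v))"
    by (simp add: inner_add_right algebra_simps)
  also have "\<bar>\<dots>\<bar> \<le> \<bar>(1 - \<tau>) * (?y \<bullet> (x + u))\<bar> + \<bar>\<tau> * (?y \<bullet> (x + v))\<bar>"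
    by (rule abs_triangle_ineq)
  also have "\<dots> = (1 - \<tau>) * \<bar>?y \<bullet> (x + u)\<bar> + \<tau> * \<bar>?y \<bullet> (x + v)\<bar>"
    using \<tau> by (simp add: abs_mult)
  finally show "\<bar>?y \<bullet> (x + ((1 - \<tau>) *\<^sub>R u + \<tau> *\<^sub>R v))\<bar>
      \<le> (1 - \<tau>) * \<bar>?y \<bullet> (x + u)\<bar> + \<tau> * \<bar>?y \<bullet> (x + v)\<bar>" .
qed

text \<open>The two error terms have separate sources: \<open>s * M * (norm (z - x))\<^sup>2\<close>
  pays for replacing \<open>z\<close> by its tangential competitor \<open>x + u\<close>, and
  \<open>s\<^sup>2 * M\<^sup>2\<close> pays for replacing the summand at \<open>x + d\<close> by its
  value at \<open>x\<close>.\<close>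

lemma manppa_dir_dist:
  fixes x z :: "real ^ 'n"
  assumes s: "s > 0" and lip: "M-lipschitz_on UNIV (obj_part Y j)"
    and x: "norm x = 1" and z: "norm z = 1"
  shows "(norm (z - x - manppa_dir Y j s x))\<^sup>2
    \<le> (norm (z - x))\<^sup>2 + 2 * s * (obj_part Y j z - obj_part Y j x)
      + s * M * (norm (z - x))\<^sup>2 + s\<^sup>2 * M\<^sup>2"
proof -
  let ?f = "obj_part Y j"
  define d where "d = manppa_dir Y j s x"
  \<comment> \<open>\<open>c\<close> is the component of \<open>z - x\<close> along the normal
    \<open>x\<close>, and \<open>u\<close> below is the tangential remainder, hence
    feasible.\<close>
  define c where "c = z \<bullet> x - 1"
  define u where "u = z - x - c *\<^sub>R x"
  have xx: "x \<bullet> x = 1" and zz: "z \<bullet> z = 1"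
    using x z by (auto simp: norm_eq_1)
  have min: "is_arg_min (\<lambda>d. ?f (x + d) + 1 / (2 * s) * (norm d)\<^sup>2) (\<lambda>d. d \<in> {d. d \<bullet> x = 0}) d"
    using is_arg_min_manppa_dir[OF s] by (simp add: d_def obj_part_def)
  then have dx: "d \<bullet> x = 0"
    by (simp add: is_arg_min_linorder)
  have ux: "u \<bullet> x = 0"
    by (simp add: u_def c_def inner_diff_left xx)
  have "?f (x + d) + 1 / (2 * s) * (norm d)\<^sup>2 + 1 / (2 * s) * (norm (u - d))\<^sup>2
      \<le> ?f (x + u) + 1 / (2 * s) * (norm u)\<^sup>2"
    using prox_three_point[OF min] convex_on_obj_part_shift[of x j Y] ux
    by (simp add: obj_part_def)
  then have "2 * s * (?f (x + d) + 1 / (2 * s) * (norm d)\<^sup>2 + 1 / (2 * s) * (norm (u - d))\<^sup>2)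
      \<le> 2 * s * (?f (x + u) + 1 / (2 * s) * (norm u)\<^sup>2)"
    using s by (intro mult_left_mono) auto
  then have three: "2 * s * ?f (x + d) + (norm d)\<^sup>2 + (norm (u - d))\<^sup>2 \<le> 2 * s * ?f (x + u) + (norm u)\<^sup>2"
    using s by (simp add: distrib_left)
  \<comment> \<open>On the sphere the normal component is of second order in the distance, so moving
    from \<open>z\<close> to \<open>x + u\<close> costs only a quadratic Lipschitz error.\<close>
  have c: "2 * \<bar>c\<bar> = (norm (z - x))\<^sup>2"
  proof -
    have "z \<bullet> x \<le> 1"
      using norm_cauchy_schwarz[of z x] x z by simp
    then show ?thesis
      by (simp add: c_def power2_norm_eq_inner inner_diff_left inner_diff_right inner_commute xx zz)
  qed
  have zxd: "z - x - d = (u - d) + c *\<^sub>R x" and zx: "z - x = u + c *\<^sub>R x"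
    by (simp_all add: u_def)
  \<comment> \<open>Pythagoras on both sides of the three-point inequality: the same
    \<open>c\<^sup>2\<close> appears twice and cancels at the end.\<close>
  have n1: "(norm (z - x - d))\<^sup>2 = (norm (u - d))\<^sup>2 + c\<^sup>2"
    unfolding zxd power2_norm_eq_inner
    using ux dx xx by (simp add: inner_add_left inner_add_right inner_diff_left inner_diff_right
        inner_commute power2_eq_square)
  have n2: "(norm (z - x))\<^sup>2 = (norm u)\<^sup>2 + c\<^sup>2"
    unfolding zx power2_norm_eq_inner
    using ux xx by (simp add: inner_add_left inner_add_right inner_commute power2_eq_square)
  have "x + u = z - c *\<^sub>R x"
    by (simp add: u_def)
  then have "\<bar>?f (x + u) - ?f z\<bar> \<le> M * \<bar>c\<bar>"
    using lipschitz_onD[OF lip, of "x + u" z] x by (simp add: dist_norm)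
  then have "s * (2 * (?f (x + u) - ?f z)) \<le> s * (M * (2 * \<bar>c\<bar>))"
    using s by (intro mult_left_mono) auto
  then have fu: "2 * s * ?f (x + u) \<le> 2 * s * ?f z + s * M * (norm (z - x))\<^sup>2"
    unfolding c by (simp add: algebra_simps)
  have "\<bar>?f (x + d) - ?f x\<bar> \<le> M * norm d"
    using lipschitz_onD[OF lip, of "x + d" x] by (simp add: dist_norm)
  then have "s * (2 * (?f x - ?f (x + d))) \<le> s * (2 * (M * norm d))"
    using s by (intro mult_left_mono) auto
  \<comment> \<open>Completing the square absorbs the Lipschitz term
    \<open>2 * s * M * norm d\<close> into the \<open>(norm d)\<^sup>2\<close> supplied by the
    three-point inequality.\<close>
  moreover have "0 \<le> (s * M - norm d)\<^sup>2"
    by simp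
  ultimately have fd: "2 * s * ?f x - 2 * s * ?f (x + d) - (norm d)\<^sup>2 \<le> s\<^sup>2 * M\<^sup>2"
    by (simp add: power2_diff power_mult_distrib algebra_simps)
  show ?thesis
    unfolding d_def[symmetric] using three n1 n2 fu fd by (simp add: algebra_simps)
qed

text \<open>The update is detached from the index sequence so that it can be averaged over the index
  at a fixed point.\<close>

definition manppa_step :: "real ^ 'p ^ 'n \<Rightarrow> 'p \<Rightarrow> real \<Rightarrow> real ^ 'n \<Rightarrow> real ^ 'n" where
  "manppa_step Y j s x = proj_sphere (x + manppa_dir Y j s x)"

lemma stmanppa_iter_Suc':
  "stmanppa_iter Y t x0 js (Suc k) = manppa_step Y (js k) (t k) (stmanppa_iter Y t x0 js k)"
  by (simp add: manppa_step_def Let_def)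

lemma norm_add_manppa_dir_ge: "s > 0 \<Longrightarrow> norm x \<le> norm (x + manppa_dir Y j s x)"
  using is_arg_min_manppa_dir[of s j Y x]
  by (intro norm_add_orthogonal_ge) (simp add: is_arg_min_linorder)

lemma norm_manppa_step:
  assumes "s > 0" "norm x = 1"
  shows "norm (manppa_step Y j s x) = 1"
  using norm_add_manppa_dir_ge[of s x Y j] assms
  unfolding manppa_step_def by (intro norm_proj_sphere) auto

lemma norm_stmanppa_iter:
  assumes "\<And>i. i < k \<Longrightarrow> t i > 0" "norm x0 = 1"
  shows "norm (stmanppa_iter Y t x0 js k) = 1"
  using assms(1)
  by (induction k) (simp_all add: assms(2) stmanppa_iter_Suc' norm_manppa_step del: stmanppa_iter.simps(2))

section \<open>The Moreau envelope\<close>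

lemma obj_nonneg: "0 \<le> obj Y x"
  by (simp add: obj_def l1_norm_def sum_nonneg)

lemma moreau_env_le:
  assumes "lam > 0" "norm u = 1"
  shows "moreau_env (obj Y) lam z \<le> obj Y u + 1 / (2 * lam) * (norm (u - z))\<^sup>2"
  unfolding moreau_env_def using assms
  by (intro cINF_lower bdd_belowI2[where m = 0]) (auto intro!: add_nonneg_nonneg obj_nonneg)

lemma moreau_env_nonneg:
  fixes Y :: "real ^ 'p ^ 'n"
  assumes "lam > 0"
  shows "0 \<le> moreau_env (obj Y) lam z"
  unfolding moreau_env_def using assms
  by (intro cINF_greatest) (auto intro!: add_nonneg_nonneg obj_nonneg)

lemma norm_mprox: "mprox_selection f lam m \<Longrightarrow> norm (m z) = 1"
  by (auto simp: mprox_selection_def is_arg_min_linorder)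

text \<open>The function minimised by the selection is \<open>lam\<close> times the one whose
  infimum is the envelope.\<close>

lemma moreau_env_mprox:
  fixes f :: "real ^ 'n \<Rightarrow> real"
  assumes lam: "lam > 0" and m: "mprox_selection f lam m"
  shows "moreau_env f lam z = f (m z) + 1 / (2 * lam) * (norm (m z - z))\<^sup>2"
  unfolding moreau_env_def
proof (rule cInf_eq_minimum)
  let ?g = "\<lambda>x. f x + 1 / (2 * lam) * (norm (x - z))\<^sup>2"
  show "?g (m z) \<in> ?g ` unit_sphere"
    using norm_mprox[OF m] by auto
  fix v assume "v \<in> ?g ` unit_sphere"
  then obtain u where u: "u \<in> unit_sphere" "v = ?g u"
    by blast
  then have "lam * f (m z) + 1 / 2 * (norm (m z - z))\<^sup>2 \<le> lam * f u + 1 / 2 * (norm (u - z))\<^sup>2"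
    using m unfolding mprox_selection_def is_arg_min_linorder by blast
  then have "lam * ?g (m z) \<le> lam * ?g u"
    using lam by (simp add: distrib_left)
  then show "?g (m z) \<le> v"
    using lam u by simp
qed

text \<open>The proximal point \<open>m x\<close> does not depend on the drawn index, so it serves
  as competitor for the envelope at every possible successor of \<open>x\<close>. Averaging then
  trades a gain of order \<open>s / CARD('p)\<close> against the curvature loss of order
  \<open>s * lam * M\<close>.\<close>

lemma moreau_env_descent:
  fixes Y :: "real ^ 'p ^ 'n" and x :: "real ^ 'n"
  assumes lip: "\<And>j. M-lipschitz_on UNIV (obj_part Y j)"
    and lam: "lam > 0" and m: "mprox_selection (obj Y) lam m"
    and s: "s > 0" and x: "norm x = 1"
  shows "(\<Sum>j\<in>UNIV. moreau_env (obj Y) lam (manppa_step Y j s x)) / CARD('p)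
    \<le> moreau_env (obj Y) lam x
      - s / 2 * (1 / CARD('p) - lam * M) * (Theta lam m x)\<^sup>2 + s\<^sup>2 * M\<^sup>2 / (2 * lam)"
proof -
  let ?e = "moreau_env (obj Y) lam" and ?p = "real CARD('p)"
  define D where "D = (norm (m x - x))\<^sup>2"
  have z: "norm (m x) = 1"
    using m by (rule norm_mprox)
  have one: "2 * lam * ?e (manppa_step Y j s x) \<le> 2 * lam * obj Y (m x) + D
      + 2 * s * (obj_part Y j (m x) - obj_part Y j x) + s * M * D + s\<^sup>2 * M\<^sup>2" for j
  proof -
    have "norm (m x - manppa_step Y j s x) \<le> norm (m x - (x + manppa_dir Y j s x))"
      unfolding manppa_step_def using norm_add_manppa_dir_ge[OF s, of x Y j] x z
      by (intro norm_proj_sphere_diff_le) auto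
    then have "(norm (m x - manppa_step Y j s x))\<^sup>2 \<le> (norm (m x - (x + manppa_dir Y j s x)))\<^sup>2"
      by (rule power_mono) simp
    also have "\<dots> \<le> D + 2 * s * (obj_part Y j (m x) - obj_part Y j x) + s * M * D + s\<^sup>2 * M\<^sup>2"
      using manppa_dir_dist[OF s lip x z] by (simp add: D_def diff_diff_eq)
    finally have "(norm (m x - manppa_step Y j s x))\<^sup>2
        \<le> D + 2 * s * (obj_part Y j (m x) - obj_part Y j x) + s * M * D + s\<^sup>2 * M\<^sup>2" .
    moreover have "2 * lam * ?e (manppa_step Y j s x)
        \<le> 2 * lam * (obj Y (m x) + 1 / (2 * lam) * (norm (m x - manppa_step Y j s x))\<^sup>2)"
      using lam by (intro mult_left_mono moreau_env_le z) auto
    ultimately show ?thesis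
      using lam by (simp add: distrib_left)
  qed
  have "2 * lam * (\<Sum>j\<in>UNIV. ?e (manppa_step Y j s x)) = (\<Sum>j\<in>UNIV. 2 * lam * ?e (manppa_step Y j s x))"
    by (simp add: sum_distrib_left)
  also have "\<dots> \<le> (\<Sum>j\<in>UNIV. 2 * lam * obj Y (m x) + D
      + 2 * s * (obj_part Y j (m x) - obj_part Y j x) + s * M * D + s\<^sup>2 * M\<^sup>2)"
    by (rule sum_mono) (rule one)
  \<comment> \<open>The differences of summands add up to a single difference of \<open>obj\<close>,
    whereas all other terms are counted \<open>?p\<close> times. This is the origin of the factor
    \<open>1 / CARD('p)\<close> in the gain.\<close>
  also have "\<dots> = ?p * (2 * lam * obj Y (m x) + D) + 2 * s * (obj Y (m x) - obj Y x)
      + ?p * (s * M * D + s\<^sup>2 * M\<^sup>2)"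
    by (simp add: obj_eq_sum sum.distrib sum_subtractf sum_distrib_left[symmetric] algebra_simps)
  also have "2 * lam * obj Y (m x) + D = 2 * lam * ?e x"
    using lam by (simp add: moreau_env_mprox[OF lam m] D_def field_simps)
  \<comment> \<open>Here \<open>x\<close> itself is the competitor for the envelope at
    \<open>x\<close>; the proximal penalty of \<open>m x\<close> bounds the drop of the objective
    from below.\<close>
  also have "2 * s * (obj Y (m x) - obj Y x) \<le> 2 * s * (- D / (2 * lam))"
    using moreau_env_le[OF lam x, of Y x] s
    by (intro mult_left_mono) (auto simp: moreau_env_mprox[OF lam m] D_def)
  finally have "2 * lam * (\<Sum>j\<in>UNIV. ?e (manppa_step Y j s x))
      \<le> ?p * (2 * lam * ?e x) + 2 * s * (- D / (2 * lam)) + ?p * (s * M * D + s\<^sup>2 * M\<^sup>2)"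
    by simp
  then have "2 * lam * (\<Sum>j\<in>UNIV. ?e (manppa_step Y j s x)) / (2 * lam * ?p)
      \<le> (?p * (2 * lam * ?e x) + 2 * s * (- D / (2 * lam)) + ?p * (s * M * D + s\<^sup>2 * M\<^sup>2)) / (2 * lam * ?p)"
    using lam by (intro divide_right_mono) auto
  also have "\<dots> = ?e x - s / 2 * (1 / ?p - lam * M) * (D / lam\<^sup>2) + s\<^sup>2 * M\<^sup>2 / (2 * lam)"
    using lam by (simp add: field_simps power2_eq_square)
  also have "D / lam\<^sup>2 = (Theta lam m x)\<^sup>2"
    by (simp add: Theta_def D_def power_divide norm_minus_commute)
  finally show ?thesis
    using lam by simp
qed

section \<open>The expectation\<close>

text \<open>With finite supports, both sides are the same finite double sum.\<close>

lemma expectation_pair_pmf_finite: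
  fixes h :: "'a \<times> 'b \<Rightarrow> real"
  assumes "finite (set_pmf A)" "finite (set_pmf B)"
  shows "measure_pmf.expectation (pair_pmf A B) h
    = measure_pmf.expectation A (\<lambda>a. measure_pmf.expectation B (\<lambda>b. h (a, b)))"
proof -
  have "measure_pmf.expectation (pair_pmf A B) h
      = (\<Sum>a\<in>set_pmf A. pmf A a * (\<Sum>b\<in>set_pmf B. pmf B b * h (a, b)))"
    unfolding pair_pmf_def using assms
    by (subst pmf_expectation_bind[where A = "set_pmf A"], simp, simp, simp)
       (subst pmf_expectation_bind[where A = "set_pmf B"], simp_all)
  then show ?thesis
    using assms by (simp add: integral_measure_pmf[where A = "set_pmf A"]
        integral_measure_pmf[where A = "set_pmf B"] mult.commute)
qed

text \<open>The default \<open>undefined\<close> occupies the positions beyond \<open>T\<close>; no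
  iterate up to number \<open>Suc T\<close> reads them.\<close>

abbreviation index_pmf :: "nat \<Rightarrow> (nat \<Rightarrow> 'p::finite) pmf" where
  "index_pmf T \<equiv> Pi_pmf {..T} undefined (\<lambda>_. pmf_of_set UNIV)"

lemma finite_set_Pi_pmf_of_set_UNIV:
  "finite A \<Longrightarrow> finite (set_pmf (Pi_pmf A dflt (\<lambda>_. pmf_of_set (UNIV :: 'p::finite set))))"
  by (simp add: set_Pi_pmf finite_PiE_dflt)

lemma stmanppa_iter_cong:
  "(\<And>i. i < k \<Longrightarrow> js i = js' i) \<Longrightarrow> stmanppa_iter Y t x0 js k = stmanppa_iter Y t x0 js' k"
  by (induction k) simp_all

text \<open>The tower property: iterate \<open>k\<close> is determined by the indices below
  \<open>k\<close>, so the index at \<open>k\<close> is still uniform given that iterate and can be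
  averaged out first.\<close>

lemma expectation_stmanppa_iter_Suc:
  fixes Y :: "real ^ 'p ^ 'n" and g :: "real ^ 'n \<Rightarrow> real"
  assumes k: "k \<le> T"
  shows "measure_pmf.expectation (index_pmf T) (\<lambda>js. g (stmanppa_iter Y t x0 js (Suc k)))
    = measure_pmf.expectation (index_pmf T)
        (\<lambda>js. (\<Sum>j\<in>UNIV. g (manppa_step Y j (t k) (stmanppa_iter Y t x0 js k))) / CARD('p))"
proof -
  \<comment> \<open>\<open>P\<close> is the law of all coordinates except \<open>k\<close>, later
    ones included; drawing coordinate \<open>k\<close> separately and inserting it restores the full
    law.\<close>
  define P where "P = Pi_pmf ({..T} - {k}) (undefined :: 'p) (\<lambda>_. pmf_of_set UNIV)"
  have T: "{..T} = insert k ({..T} - {k})"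
    using k by auto
  have idx: "index_pmf T = map_pmf (\<lambda>(y, f). f(k := y)) (pair_pmf (pmf_of_set (UNIV :: 'p set)) P)"
    unfolding P_def by (subst T, rule Pi_pmf_insert) auto
  have fin: "finite (set_pmf P)"
    unfolding P_def by (rule finite_set_Pi_pmf_of_set_UNIV) simp
  have upd: "stmanppa_iter Y t x0 (js(k := y)) k = stmanppa_iter Y t x0 js k" for js y
    by (rule stmanppa_iter_cong) simp
  have int: "integrable (measure_pmf P) h" for h :: "_ \<Rightarrow> real"
    using fin by (rule integrable_measure_pmf_finite)
  show ?thesis
    unfolding idx integral_map_pmf
    by (simp add: expectation_pair_pmf_finite fin case_prod_unfold stmanppa_iter_Suc' upd
        integral_pmf_of_set Bochner_Integration.integral_sum int
        del: stmanppa_iter.simps(2))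
qed

text \<open>Every realisation keeps the iterates on the sphere, so the averaged one-step descent
  applies pointwise and can be integrated.\<close>

lemma expectation_moreau_env_descent:
  fixes Y :: "real ^ 'p ^ 'n" and x0 :: "real ^ 'n"
  assumes lip: "\<And>j. M-lipschitz_on UNIV (obj_part Y j)"
    and lam: "lam > 0" and m: "mprox_selection (obj Y) lam m"
    and t: "\<And>k. k \<le> T \<Longrightarrow> t k > 0" and x0: "norm x0 = 1" and k: "k \<le> T"
  shows "measure_pmf.expectation (index_pmf T) (\<lambda>js. moreau_env (obj Y) lam (stmanppa_iter Y t x0 js (Suc k)))
    \<le> measure_pmf.expectation (index_pmf T) (\<lambda>js. moreau_env (obj Y) lam (stmanppa_iter Y t x0 js k))
      - t k / 2 * (1 / CARD('p) - lam * M)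
          * measure_pmf.expectation (index_pmf T) (\<lambda>js. (Theta lam m (stmanppa_iter Y t x0 js k))\<^sup>2)
      + (t k)\<^sup>2 * M\<^sup>2 / (2 * lam)"
proof -
  let ?I = "index_pmf T :: (nat \<Rightarrow> 'p) pmf" and ?x = "\<lambda>js. stmanppa_iter Y t x0 js k"
  let ?e = "moreau_env (obj Y) lam"
  have int: "integrable (measure_pmf ?I) h" for h :: "_ \<Rightarrow> real"
    by (intro integrable_measure_pmf_finite finite_set_Pi_pmf_of_set_UNIV) simp
  have "measure_pmf.expectation ?I (\<lambda>js. ?e (stmanppa_iter Y t x0 js (Suc k)))
      = measure_pmf.expectation ?I (\<lambda>js. (\<Sum>j\<in>UNIV. ?e (manppa_step Y j (t k) (?x js))) / CARD('p))"
    using k by (rule expectation_stmanppa_iter_Suc)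
  also have "\<dots> \<le> measure_pmf.expectation ?I (\<lambda>js. ?e (?x js)
      - t k / 2 * (1 / CARD('p) - lam * M) * (Theta lam m (?x js))\<^sup>2 + (t k)\<^sup>2 * M\<^sup>2 / (2 * lam))"
    using t k x0 by (intro integral_mono int moreau_env_descent lip lam m norm_stmanppa_iter) auto
  also have "\<dots> = measure_pmf.expectation ?I (\<lambda>js. ?e (?x js))
      - t k / 2 * (1 / CARD('p) - lam * M) * measure_pmf.expectation ?I (\<lambda>js. (Theta lam m (?x js))\<^sup>2)
      + (t k)\<^sup>2 * M\<^sup>2 / (2 * lam)"
    by (simp add: int)
  finally show ?thesis .
qed

section \<open>The law of the output\<close>

lemma set_output_index:
  assumes "\<And>k. k \<le> T \<Longrightarrow> t k > 0"
  shows "set_pmf (output_index t T) \<subseteq> {..T}"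
  by (auto simp: set_pmf_iff pmf_output_index[OF assms] split: if_splits)

lemma finite_set_stmanppa:
  fixes Y :: "real ^ 'p ^ 'n"
  assumes "\<And>k. k \<le> T \<Longrightarrow> t k > 0"
  shows "finite (set_pmf (stmanppa Y t x0 T))"
  using finite_subset[OF set_output_index[OF assms]]
    finite_set_Pi_pmf_of_set_UNIV[of "{..T}" "undefined :: 'p"]
  by (simp add: stmanppa_def)

lemma set_stmanppa_subset:
  fixes Y :: "real ^ 'p ^ 'n" and x0 :: "real ^ 'n"
  assumes t: "\<And>k. k \<le> T \<Longrightarrow> t k > 0" and x0: "norm x0 = 1"
  shows "set_pmf (stmanppa Y t x0 T) \<subseteq> unit_sphere"
proof
  fix x assume "x \<in> set_pmf (stmanppa Y t x0 T)"
  then obtain js k where "x = stmanppa_iter Y t x0 js k" "k \<in> set_pmf (output_index t T)"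
    by (auto simp: stmanppa_def)
  with set_output_index[of T t] t have "norm x = 1"
    by (auto intro!: norm_stmanppa_iter x0)
  then show "x \<in> unit_sphere" by simp
qed

text \<open>Independence of the output index turns the expectation into a weighted mean over the
  iterates. The weights \<open>t k\<close> are the same factors that multiply the gain in the
  descent inequality.\<close>

lemma expectation_stmanppa:
  fixes Y :: "real ^ 'p ^ 'n" and g :: "real ^ 'n \<Rightarrow> real"
  assumes t: "\<And>k. k \<le> T \<Longrightarrow> t k > 0"
  shows "measure_pmf.expectation (stmanppa Y t x0 T) g
    = (\<Sum>k\<le>T. t k * measure_pmf.expectation (index_pmf T) (\<lambda>js. g (stmanppa_iter Y t x0 js k)))
      / (\<Sum>k\<le>T. t k)"
proof -
  let ?I = "index_pmf T :: (nat \<Rightarrow> 'p) pmf"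
  have fin: "finite (set_pmf ?I)"
    by (rule finite_set_Pi_pmf_of_set_UNIV) simp
  have int: "integrable (measure_pmf ?I) h" for h :: "_ \<Rightarrow> real"
    using fin by (rule integrable_measure_pmf_finite)
  have out: "measure_pmf.expectation (output_index t T) h = (\<Sum>k\<le>T. h k * (t k / (\<Sum>i\<le>T. t i)))"
    for h :: "nat \<Rightarrow> real"
    using set_output_index[of T t] t
    by (subst integral_measure_pmf_real[where A = "{..T}"]) (auto simp: pmf_output_index[OF t])
  have "measure_pmf.expectation (stmanppa Y t x0 T) g = measure_pmf.expectation ?I
      (\<lambda>js. \<Sum>k\<le>T. g (stmanppa_iter Y t x0 js k) * (t k / (\<Sum>i\<le>T. t i)))"
    using finite_subset[OF set_output_index[OF t]]
    by (simp add: stmanppa_def case_prod_unfold expectation_pair_pmf_finite fin out)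
  also have "\<dots> = (\<Sum>k\<le>T. measure_pmf.expectation ?I (\<lambda>js. g (stmanppa_iter Y t x0 js k))
      * (t k / (\<Sum>i\<le>T. t i)))"
    by (simp add: Bochner_Integration.integral_sum int)
  finally show ?thesis
    by (simp add: sum_divide_distrib mult.commute)
qed

lemma expectation_Theta_square_le:
  fixes Y :: "real ^ 'p ^ 'n" and x0 :: "real ^ 'n"
  assumes lip: "\<And>j. M-lipschitz_on UNIV (obj_part Y j)"
    and lam: "lam > 0" "lam * M < 1 / CARD('p)" and m: "mprox_selection (obj Y) lam m"
    and t: "\<And>k. k \<le> T \<Longrightarrow> t k > 0" and x0: "norm x0 = 1"
  shows "measure_pmf.expectation (stmanppa Y t x0 T) (\<lambda>x. (Theta lam m x)\<^sup>2)
    \<le> (2 * lam * moreau_env (obj Y) lam x0 + M\<^sup>2 * (\<Sum>k\<le>T. (t k)\<^sup>2))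
      / (lam * (1 / CARD('p) - lam * M) * (\<Sum>k\<le>T. t k))"
proof -
  let ?I = "index_pmf T :: (nat \<Rightarrow> 'p) pmf"
  define e where "e k = measure_pmf.expectation ?I (\<lambda>js. moreau_env (obj Y) lam (stmanppa_iter Y t x0 js k))" for k
  define \<theta> where "\<theta> k = measure_pmf.expectation ?I (\<lambda>js. (Theta lam m (stmanppa_iter Y t x0 js k))\<^sup>2)" for k
  define a where "a = 1 / CARD('p) - lam * M"
  have a: "a > 0"
    using lam by (simp add: a_def)
  have S: "(\<Sum>k\<le>T. t k) > 0"
    using t by (intro sum_pos) auto
  \<comment> \<open>The descent inequality multiplied by \<open>2 * lam\<close>, arranged so that
    the envelope terms telescope.\<close>
  have step: "lam * a * (t k * \<theta> k) \<le> 2 * lam * (e k - e (Suc k)) + M\<^sup>2 * (t k)\<^sup>2" if "k \<le> T" for k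
  proof -
    have "e (Suc k) \<le> e k - t k / 2 * a * \<theta> k + (t k)\<^sup>2 * M\<^sup>2 / (2 * lam)"
      unfolding e_def \<theta>_def a_def
      by (rule expectation_moreau_env_descent[OF lip lam(1) m t x0 that])
    then show ?thesis
      using lam(1) by (simp add: field_simps)
  qed
  have "lam * a * (\<Sum>k\<le>T. t k * \<theta> k) = (\<Sum>k\<le>T. lam * a * (t k * \<theta> k))"
    by (rule sum_distrib_left)
  also have "\<dots> \<le> (\<Sum>k\<le>T. 2 * lam * (e k - e (Suc k)) + M\<^sup>2 * (t k)\<^sup>2)"
    using step by (intro sum_mono) auto
  also have "\<dots> = 2 * lam * (e 0 - e (Suc T)) + M\<^sup>2 * (\<Sum>k\<le>T. (t k)\<^sup>2)"
    by (simp add: sum.distrib sum_distrib_left[symmetric] sum_telescope)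
  \<comment> \<open>The telescoped sum ends one iterate past the last possible output; that envelope
    value is nonnegative and is dropped.\<close>
  also have "\<dots> \<le> 2 * lam * e 0 + M\<^sup>2 * (\<Sum>k\<le>T. (t k)\<^sup>2)"
  proof -
    have "e (Suc T) \<ge> 0"
      unfolding e_def by (intro integral_nonneg_AE AE_I2 moreau_env_nonneg lam)
    then show ?thesis
      using lam by simp
  qed
  also have "e 0 = moreau_env (obj Y) lam x0"
    by (simp add: e_def)
  finally have "(\<Sum>k\<le>T. t k * \<theta> k)
      \<le> (2 * lam * moreau_env (obj Y) lam x0 + M\<^sup>2 * (\<Sum>k\<le>T. (t k)\<^sup>2)) / (lam * a)"
    using a lam by (simp add: pos_le_divide_eq mult.commute)
  then have "(\<Sum>k\<le>T. t k * \<theta> k) / (\<Sum>k\<le>T. t k)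
      \<le> (2 * lam * moreau_env (obj Y) lam x0 + M\<^sup>2 * (\<Sum>k\<le>T. (t k)\<^sup>2)) / (lam * a) / (\<Sum>k\<le>T. t k)"
    using S by (intro divide_right_mono) auto
  then show ?thesis
    by (simp add: expectation_stmanppa t \<theta>_def a_def)
qed

text \<open>Jensen's inequality for the square, read off from the nonnegativity of the
  variance.\<close>

lemma expectation_square_le:
  fixes g :: "'a \<Rightarrow> real"
  assumes "finite (set_pmf P)"
  shows "(measure_pmf.expectation P g)\<^sup>2 \<le> measure_pmf.expectation P (\<lambda>x. (g x)\<^sup>2)"
proof -
  have "integrable (measure_pmf P) h" for h :: "'a \<Rightarrow> real"
    using assms by (rule integrable_measure_pmf_finite)
  then show ?thesis
    using measure_pmf.variance_eq[of P g] measure_pmf.variance_positive[of P g] by simp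
qed

theorem theorem3p2:
  fixes Y :: "real ^ 'p ^ 'n"
    and L :: "'p \<Rightarrow> real"
    and Lbar lam :: real
    and mprox :: "real ^ 'n \<Rightarrow> real ^ 'n"
    and x0 :: "real ^ 'n"
  assumes L_pos: "\<And>j. L j > 0"
    and L_lipschitz: "\<And>j. (L j)-lipschitz_on UNIV (obj_part Y j)"
    and Lbar: "Lbar = Max (range L)"
    and lam: "0 < lam" "lam < 1 / (real CARD('p) * Lbar)"
    and mprox: "mprox_selection (obj Y) lam mprox"
    and x0: "x0 \<in> unit_sphere"
  shows
    "(\<forall>(t :: nat \<Rightarrow> real) T. (\<forall>k\<le>T. t k > 0) \<longrightarrow>
        measure_pmf.expectation (stmanppa Y t x0 T) (\<lambda>x. (Theta lam mprox x)\<^sup>2)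
          \<le> (2 * lam * moreau_env (obj Y) lam x0 + Lbar\<^sup>2 * (\<Sum>k\<le>T. (t k)\<^sup>2))
             / (lam * (1 / real CARD('p) - lam * Lbar) * (\<Sum>k\<le>T. t k)))
     \<and> (\<forall>t :: nat \<Rightarrow> real. (\<forall>k. t k > 0)
          \<and> filterlim (\<lambda>T. \<Sum>k\<le>T. t k) at_top sequentially
          \<and> summable (\<lambda>k. (t k)\<^sup>2) \<longrightarrow>
        (\<lambda>T. measure_pmf.expectation (stmanppa Y t x0 T) (\<lambda>x. (Theta lam mprox x)\<^sup>2))
          \<longlonglongrightarrow> 0)
     \<and> (\<exists>C>0. \<forall>\<epsilon>>0. \<forall>T :: nat. real (T + 1) \<ge> C * \<epsilon> powi (-4) \<longrightarrow>
          set_pmf (stmanppa Y (\<lambda>_. 1 / sqrt (real (T + 1))) x0 T) \<subseteq> unit_sphere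
          \<and> measure_pmf.expectation (stmanppa Y (\<lambda>_. 1 / sqrt (real (T + 1))) x0 T)
               (Theta lam mprox) \<le> \<epsilon>)"
proof -
  have LM: "L j \<le> Lbar" for j
    by (simp add: Lbar)
  have lip: "Lbar-lipschitz_on UNIV (obj_part Y j)" for j
    by (rule lipschitz_on_mono[OF L_lipschitz[of j]]) (use LM in auto)
  have Lbar_pos: "Lbar > 0"
    using L_pos LM by (rule less_le_trans)
  have lam': "lam * Lbar < 1 / real CARD('p)"
    using lam Lbar_pos by (simp add: field_simps)
  have x0': "norm x0 = 1"
    using x0 by simp
  let ?e = "2 * lam * moreau_env (obj Y) lam x0" and ?b = "lam * (1 / real CARD('p) - lam * Lbar)"
  have b: "?b > 0"
    using lam lam' by simp
  have e: "?e \<ge> 0"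
    using lam moreau_env_nonneg[OF lam(1), of Y x0] by simp
  \<comment> \<open>The positivity of the step sizes stays open, so that the same bound serves all
    three claims.\<close>
  note bound = expectation_Theta_square_le[OF lip lam(1) lam' mprox _ x0']
  show ?thesis
  proof (intro conjI)
    show "\<forall>(t :: nat \<Rightarrow> real) T. (\<forall>k\<le>T. t k > 0) \<longrightarrow>
        measure_pmf.expectation (stmanppa Y t x0 T) (\<lambda>x. (Theta lam mprox x)\<^sup>2)
          \<le> (?e + Lbar\<^sup>2 * (\<Sum>k\<le>T. (t k)\<^sup>2)) / (?b * (\<Sum>k\<le>T. t k))"
      using bound by blast
  next
    show "\<forall>t :: nat \<Rightarrow> real. (\<forall>k. t k > 0)
          \<and> filterlim (\<lambda>T. \<Sum>k\<le>T. t k) at_top sequentially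
          \<and> summable (\<lambda>k. (t k)\<^sup>2) \<longrightarrow>
        (\<lambda>T. measure_pmf.expectation (stmanppa Y t x0 T) (\<lambda>x. (Theta lam mprox x)\<^sup>2))
          \<longlonglongrightarrow> 0"
    proof (intro allI impI, elim conjE)
      fix t :: "nat \<Rightarrow> real"
      assume t: "\<forall>k. t k > 0" and div: "filterlim (\<lambda>T. \<Sum>k\<le>T. t k) at_top sequentially"
        and summ: "summable (\<lambda>k. (t k)\<^sup>2)"
      let ?E = "\<lambda>T. measure_pmf.expectation (stmanppa Y t x0 T) (\<lambda>x. (Theta lam mprox x)\<^sup>2)"
      let ?B = "\<lambda>T. (?e + Lbar\<^sup>2 * (\<Sum>k\<le>T. (t k)\<^sup>2)) / (?b * (\<Sum>k\<le>T. t k))"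
      have sq: "(\<lambda>T. \<Sum>k\<le>T. (t k)\<^sup>2) \<longlonglongrightarrow> (\<Sum>k. (t k)\<^sup>2)"
        using summ by (rule summable_LIMSEQ')
      have "filterlim (\<lambda>T. ?b * (\<Sum>k\<le>T. t k)) at_top sequentially"
        using b div by (intro filterlim_tendsto_pos_mult_at_top[OF tendsto_const])
      \<comment> \<open>The numerator converges because the squares are summable, while the
        denominator diverges.\<close>
      then have "?B \<longlonglongrightarrow> 0"
        by (intro tendsto_divide_0[OF tendsto_add[OF tendsto_const tendsto_mult[OF tendsto_const sq]]]
            filterlim_at_top_imp_at_infinity)
      moreover have "\<forall>T. ?E T \<le> ?B T"
        using bound t by blast
      ultimately show "?E \<longlonglongrightarrow> 0"
        by (intro tendsto_sandwich[of "\<lambda>_. 0" ?E sequentially ?B]) auto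
    qed
  next
    \<comment> \<open>For the constant step 1 / sqrt (T + 1) the squares sum to 1 and the steps sum
      to sqrt (T + 1), so the bound reads A / sqrt (T + 1) with \<open>A\<close> independent of
      \<open>T\<close> and \<epsilon>.\<close>
    define A where "A = (?e + Lbar\<^sup>2) / ?b"
    have A: "A > 0"
      unfolding A_def using e b Lbar_pos by (intro divide_pos_pos add_nonneg_pos) auto
    show "\<exists>C>0. \<forall>\<epsilon>>0. \<forall>T :: nat. real (T + 1) \<ge> C * \<epsilon> powi (-4) \<longrightarrow>
          set_pmf (stmanppa Y (\<lambda>_. 1 / sqrt (real (T + 1))) x0 T) \<subseteq> unit_sphere
          \<and> measure_pmf.expectation (stmanppa Y (\<lambda>_. 1 / sqrt (real (T + 1))) x0 T)
               (Theta lam mprox) \<le> \<epsilon>"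
    \<comment> \<open>The second moment must be at most \<open>\<epsilon>\<^sup>2\<close>, that is,
      A / sqrt (T + 1) is at most \<open>\<epsilon>\<^sup>2\<close>; squaring gives the fourth power
      and the constant \<open>A\<^sup>2\<close>.\<close>
    proof (intro exI[of _ "A\<^sup>2"] conjI allI impI)
      show "A\<^sup>2 > 0"
        using A by simp
      fix \<epsilon> :: real and T :: nat
      assume \<epsilon>: "\<epsilon> > 0" and T: "real (T + 1) \<ge> A\<^sup>2 * \<epsilon> powi (-4)"
      define r where "r = sqrt (real (T + 1))"
      have r: "r > 0" and r2: "r\<^sup>2 = real (T + 1)"
        by (simp_all add: r_def)
      let ?P = "stmanppa Y (\<lambda>_. 1 / sqrt (real (T + 1))) x0 T"
      show "set_pmf ?P \<subseteq> unit_sphere"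
        by (rule set_stmanppa_subset) (use x0' in auto)
      have fin: "finite (set_pmf ?P)"
        by (rule finite_set_stmanppa) simp
      have "\<epsilon> powi (-4) = 1 / \<epsilon> ^ 4"
        by (simp add: power_int_minus divide_inverse)
      then have "A\<^sup>2 \<le> real (T + 1) * \<epsilon> ^ 4"
        using T \<epsilon> by (simp add: pos_divide_le_eq del: power_int_minus)
      also have "\<dots> = (r * \<epsilon>\<^sup>2)\<^sup>2"
        using r2 by (simp add: power_mult_distrib)
      finally have "A \<le> r * \<epsilon>\<^sup>2"
        by (rule power2_le_imp_le) (use r in simp)
      then have Ar: "A / r \<le> \<epsilon>\<^sup>2"
        using r by (simp add: pos_divide_le_eq mult.commute)
      have "measure_pmf.expectation ?P (\<lambda>x. (Theta lam mprox x)\<^sup>2)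
          \<le> (?e + Lbar\<^sup>2 * (\<Sum>k\<le>T. (1 / r)\<^sup>2)) / (?b * (\<Sum>k\<le>T. 1 / r))"
        unfolding r_def by (rule bound) simp
      also have "(\<Sum>k\<le>T. (1 / r)\<^sup>2) = 1"
        using r2 by (simp add: power_divide)
      also have "(\<Sum>k\<le>T. 1 / r) = r"
        using r r2 by (simp add: field_simps power2_eq_square)
      finally have "measure_pmf.expectation ?P (\<lambda>x. (Theta lam mprox x)\<^sup>2) \<le> A / r"
        by (simp add: A_def)
      \<comment> \<open>Jensen's inequality passes from the second moment to the first.\<close>
      with Ar expectation_square_le[OF fin, of "Theta lam mprox"]
      have "(measure_pmf.expectation ?P (Theta lam mprox))\<^sup>2 \<le> \<epsilon>\<^sup>2"
        by linarith
      then show "measure_pmf.expectation ?P (Theta lam mprox) \<le> \<epsilon>"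
        by (rule power2_le_imp_le) (use \<epsilon> in simp)
    qed
  qed
qed

end
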